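(* Let $n\geq 2$ and $C\geq 1$. Suppose that to every $B\in M_n(\mathbb C)$ there is assigned a compact set $\mathcal K(B)\subset\mathbb C$ which is a $C$-spectral set for $B$. Let $A\in M_n(\mathbb C)$, and let $D\subset\mathbb C$ be a bounded convex domain containing $\sigma(A)$. If $\gamma>1$ and $$\mathcal K(S^{-1}AS)\Subset D\qquad\text{whenever } S\in M_n(\mathbb C) \text{ is invertible and } \kappa(S)<\gamma,$$ then $$\mathcal M_D(A)\leq\max\left\{1,\frac{C}{\gamma}\right\}.$$
   Context: $M_n(\mathbb C)$ is the set of complex $n\times n$ matrices, with the operator norm induced by the Euclidean norm on $\mathbb C^n$; $\sigma(B)$ is the spectrum of $B$. A domain is a nonempty connected open subset of $\mathbb C$. For invertible $S$, $\kappa(S)=\|S\|\,\|S^{-1}\|$. For a compact set $K$ and an open set $U$, $K\Subset U$ means that $K$ is contained in $U$. For $C\geq 1$ and a compact set $K\subset\mathbb C$ with $\sigma(B)\subset K$, $K$ is a $C$-spectral set for $B$ if $\|f(B)\|\leq C\max_{z\in K}|f(z)|$ for every rational function $f$ with poles off $K$ (equivalently, for every function $f$ holomorphic on a neighbourhood of $K$). The least such $C\geq 1$ is called the optimal spectral constant of $K$ for $B$. For a bounded convex domain $D$ and $B\in M_n(\mathbb C)$ with $\sigma(B)\subset D$, $\mathcal M_D(B)$ denotes the optimal spectral constant of $\overline D$ for $B$. Equivalently, $\mathcal M_D(B)=\sup\{\|f(B)\| : f\in\mathcal A(\overline D),\ \max_{\overline D}|f|\leq 1\}$, where $\mathcal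 A(\overline D)$ is the set of functions continuous on $\overline D$ and holomorphic in $D$, and $f(B)$ is defined by the holomorphic functional calculus. *)

theory Defs
  imports "HOL-Analysis.Analysis" "HOL-Computational_Algebra.Polynomial"
begin

text \<open>
  Matrices in \<open>M_n(\<complex>)\<close> are elements of \<^typ>\<open>complex^'n^'n\<close> with \<open>n = CARD('n)\<close>. The
  norm on \<^typ>\<open>complex^'n\<close> is the Euclidean one. Note that \<open>norm\<close>, \<open>*\<close> and \<open>^\<close> on the
  matrix type itself are entrywise notions (Frobenius norm, componentwise product), so they
  are not used here.
\<close>

definition opnorm :: "complex^'n^'n \<Rightarrow> real" where
  "opnorm B = onorm (\<lambda>x. B *v x)"

definition spectrum :: "complex^'n^'n \<Rightarrow> complex set" where
  "spectrum B = {z. \<not> invertible (mat z - B)}"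

definition cond_number :: "complex^'n^'n \<Rightarrow> real" where
  "cond_number S = opnorm S * opnorm (matrix_inv S)"

primrec matrix_power :: "complex^'n^'n \<Rightarrow> nat \<Rightarrow> complex^'n^'n" where
  "matrix_power B 0 = mat 1"
| "matrix_power B (Suc k) = B ** matrix_power B k"

definition matrix_poly :: "complex poly \<Rightarrow> complex^'n^'n \<Rightarrow> complex^'n^'n" where
  "matrix_poly p B = (\<Sum>i\<le>degree p. mat (coeff p i) ** matrix_power B i)"

text \<open>
  A rational function with poles off \<open>K\<close> is a quotient \<open>p / q\<close> of polynomials where \<open>q\<close> has
  no zero in \<open>K\<close>. If \<open>K\<close> contains the spectrum of \<open>B\<close>, then \<open>q(B)\<close> is invertible and the
  value of the function at \<open>B\<close> is \<open>p(B) q(B)\<inverse>\<close>.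
\<close>

definition matrix_ratfun :: "complex poly \<Rightarrow> complex poly \<Rightarrow> complex^'n^'n \<Rightarrow> complex^'n^'n" where
  "matrix_ratfun p q B = matrix_poly p B ** matrix_inv (matrix_poly q B)"

text \<open>
  The supremum below is a maximum: \<open>K\<close> is compact, and it is nonempty because it contains
  the spectrum of \<open>B\<close>.
\<close>

definition spectral_set :: "real \<Rightarrow> complex set \<Rightarrow> complex^'n^'n \<Rightarrow> bool" where
  "spectral_set C K B \<longleftrightarrow>
     1 \<le> C \<and> compact K \<and> spectrum B \<subseteq> K \<and>
     (\<forall>p q. (\<forall>z\<in>K. poly q z \<noteq> 0) \<longrightarrow>
        opnorm (matrix_ratfun p q B) \<le> C * (SUP z\<in>K. cmod (poly p z / poly q z)))"

text \<open>
  The least admissible constant. It is taken in the extended reals so that it is \<open>\<infinity>\<close>, rather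
  than an unspecified real, if there is no admissible constant. Lemma
  \<open>optimal_spectral_constant_le_iff\<close> shows that the infimum is attained otherwise.
\<close>

definition optimal_spectral_constant :: "complex set \<Rightarrow> complex^'n^'n \<Rightarrow> ereal" where
  "optimal_spectral_constant K B = Inf {ereal C | C. spectral_set C K B}"

lemma optimal_spectral_constant_le_iff:
  assumes "1 \<le> c"
  shows "optimal_spectral_constant K B \<le> ereal c \<longleftrightarrow> spectral_set c K B"
proof
  assume "spectral_set c K B"
  then show "optimal_spectral_constant K B \<le> ereal c"
    unfolding optimal_spectral_constant_def by (intro Inf_lower) auto
next
  assume le: "optimal_spectral_constant K B \<le> ereal c"
  have ex: "\<exists>C. spectral_set C K B \<and> C < c + e" if "e > 0" for e
  proof -
    have "ereal c < ereal (c + e)" using that by simp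
    with le have "Inf {ereal C | C. spectral_set C K B} < ereal (c + e)"
      unfolding optimal_spectral_constant_def by (rule le_less_trans)
    then show ?thesis by (auto simp: Inf_less_iff)
  qed
  obtain C0 where C0: "spectral_set C0 K B" using ex[of 1] by auto
  have "opnorm (matrix_ratfun p q B) \<le> c * (SUP z\<in>K. cmod (poly p z / poly q z))"
    if q: "\<forall>z\<in>K. poly q z \<noteq> 0" for p q
  proof -
    let ?s = "SUP z\<in>K. cmod (poly p z / poly q z)"
    let ?N = "opnorm (matrix_ratfun p q B)"
    have bd: "?N \<le> C * ?s" if "spectral_set C K B" for C
      using that q unfolding spectral_set_def by blast
    have "0 \<le> ?N"
      unfolding opnorm_def by (intro onorm_pos_le matrix_vector_mul_bounded_linear)
    with bd[OF C0] C0 have s: "0 \<le> ?s"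
      unfolding spectral_set_def by (smt (verit) mult_pos_neg)
    have le: "?N \<le> c * ?s + e * ?s" if e: "e > 0" for e
    proof -
      obtain C where C: "spectral_set C K B" "C < c + e" using ex[OF e] by auto
      have "?N \<le> C * ?s" using bd[OF C(1)] .
      also have "\<dots> \<le> (c + e) * ?s" using C(2) s by (intro mult_right_mono) auto
      finally show ?thesis by (simp add: distrib_right)
    qed
    show ?thesis
    proof (rule field_le_epsilon)
      fix e :: real assume "e > 0"
      then have pos: "e / (?s + 1) > 0" using s by simp
      have "e / (?s + 1) * ?s \<le> e" using s \<open>e > 0\<close> by (simp add: field_simps)
      with le[OF pos] show "?N \<le> c * ?s + e" by linarith
    qed
  qed
  then show "spectral_set c K B"
    using C0 assms unfolding spectral_set_def by blast
qed

text \<open>\<open>\<M>\<^sub>D(B)\<close> for a bounded convex domain \<open>D\<close> containing the spectrum of \<open>B\<close>.\<close>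

definition spectral_constant :: "complex set \<Rightarrow> complex^'n^'n \<Rightarrow> ereal" where
  "spectral_constant D B = optimal_spectral_constant (closure D) B"

end

theory Submission
  imports Defs "HOL-Computational_Algebra.Fundamental_Theorem_Algebra"
begin

text \<open>
  If \<open>M > 1\<close> is the largest value of \<open>\<parallel>f(A)\<parallel>\<close> over functions \<open>f\<close> bounded by \<open>1\<close> on the closure
  of \<open>D\<close>, attained as \<open>u = f(A)x\<close> with \<open>x\<close> a unit vector, then replacing \<open>f\<close> by \<open>\<phi> \<circ> f\<close> for
  automorphisms \<open>\<phi>\<close> of the disc shows that \<open>u\<close> is orthogonal to \<open>x\<close>. Hence for each \<open>s\<close> in
  \<open>[1, \<gamma>)\<close> there is an \<open>S\<close> with \<open>\<kappa>(S) \<le> s\<close>, \<open>S\<^sup>-\<^sup>1 x = x\<close> and \<open>S\<^sup>-\<^sup>1 u = s u\<close>, so that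
  \<open>s M \<le> \<parallel>f(S\<^sup>-\<^sup>1 A S)\<parallel> \<le> C\<close>. In place of an extremal \<open>f\<close>, whose existence would require work,
  a limit of pairs \<open>(x, f(A)x)\<close> with rational \<open>f\<close> suffices.
\<close>

section \<open>Functional calculus\<close>

lemma mat_vector_mult: "mat a *v x = a *s (x :: 'a::comm_semiring_1^'n)"
  by (simp add: vec_eq_iff matrix_vector_mult_def mat_def if_distrib if_distribR cong: if_cong)

lemma mat_commute: "B ** mat a = mat a ** (B :: 'a::field^'n^'n)"
  by (simp add: matrix_eq matrix_vector_mul_assoc[symmetric] mat_vector_mult vector_scalar_commute)

lemma matrix_add_rdistrib: "(A + B) ** C = A ** C + B ** C"
  by (simp add: vec_eq_iff matrix_matrix_mult_def distrib_right sum.distrib)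

lemma matrix_mult_sum_right:
  "B ** (\<Sum>i\<in>I. f i) = (\<Sum>i\<in>I. B ** f i)" for B :: "'a::comm_ring_1^'n^'m"
  by (induction I rule: infinite_finite_induct) (auto simp: matrix_add_ldistrib)

lemma matrix_poly_0: "matrix_poly 0 B = 0"
  by (simp add: matrix_poly_def)

lemma matrix_poly_pCons:
  fixes B :: "complex^'n^'n"
  shows "matrix_poly (pCons a p) B = mat a + B ** matrix_poly p B"
proof (cases "p = 0")
  case True
  then show ?thesis by (simp add: matrix_poly_def)
next
  case False
  have "mat c ** (B ** P) = B ** (mat c ** P)" for c and P :: "complex^'n^'n"
    by (metis mat_commute matrix_mul_assoc)
  then show ?thesis using False
    by (simp add: matrix_poly_def sum.atMost_Suc_shift matrix_mult_sum_right del: sum.atMost_Suc)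
qed

lemma matrix_poly_const: "matrix_poly [:a:] B = mat a"
  by (simp add: matrix_poly_pCons matrix_poly_0)

text \<open>Scalars act on vectors by \<open>*s\<close> but enter matrix products as
  \<open>mat a\<close>, so linearity of the calculus in the polynomial is expressed on
  vectors.\<close>

lemma matrix_poly_add_vector:
  "matrix_poly (p + q) B *v x = matrix_poly p B *v x + matrix_poly q B *v x"
  by (induction p q arbitrary: x rule: poly_induct2)
    (simp_all add: matrix_poly_0 matrix_poly_pCons matrix_vector_mult_add_rdistrib
      matrix_vector_right_distrib mat_vector_mult vector_sadd_rdistrib
      flip: matrix_vector_mul_assoc)

lemma matrix_poly_smult_vector: "matrix_poly (smult a p) B *v x = a *s (matrix_poly p B *v x)"
  by (induction p arbitrary: x)
    (simp_all add: matrix_poly_0 matrix_poly_pCons matrix_vector_mult_add_rdistrib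
      matrix_vector_right_distrib mat_vector_mult vector_add_ldistrib vector_smult_assoc
      vector_scalar_commute flip: matrix_vector_mul_assoc)

text \<open>Splitting off one root at a time suffices for the invertibility of \<open>q(B)\<close>,
  so full multiplicativity of the calculus is avoided.\<close>

lemma matrix_poly_linear_factor:
  "matrix_poly ([:-r, 1:] * p) B = (B - mat r) ** matrix_poly p B"
proof -
  have "[:-r, 1:] * p = smult (-r) p + pCons 0 p" by simp
  then show ?thesis
    by (simp only: matrix_eq matrix_poly_add_vector matrix_poly_smult_vector)
      (simp add: matrix_poly_pCons matrix_vector_mult_diff_rdistrib mat_vector_mult flip: matrix_vector_mul_assoc)
qed

section \<open>Matrix inverses, rational functions of a matrix and similarity\<close>

lemma matrix_inv_right: "invertible B \<Longrightarrow> B ** matrix_inv B = mat 1"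
  and matrix_inv_left: "invertible B \<Longrightarrow> matrix_inv B ** B = mat 1"
  unfolding invertible_def matrix_inv_def by (metis (mono_tags, lifting) someI_ex)+

lemma matrix_inv_unique:
  fixes P Q :: "'a::comm_ring_1^'n^'n"
  assumes "P ** Q = mat 1" "Q ** P = mat 1"
  shows "matrix_inv P = Q"
proof -
  have "invertible P" using assms by (auto simp: invertible_def)
  then have "matrix_inv P ** P = mat 1" by (rule matrix_inv_left)
  then show ?thesis by (metis assms(1) matrix_mul_assoc matrix_mul_lid matrix_mul_rid)
qed

lemma matrix_inv_mat_1: "matrix_inv (mat 1 :: 'a::comm_ring_1^'n^'n) = mat 1"
  by (rule matrix_inv_unique) simp_all

lemma invertible_mat:
  assumes "a \<noteq> 0"
  shows "invertible (mat a :: 'a::field^'n^'n)"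
  unfolding invertible_def
  by (rule exI[of _ "mat (1/a)"])
    (use assms in \<open>simp add: matrix_eq mat_vector_mult vector_smult_assoc
       flip: matrix_vector_mul_assoc\<close>)

text \<open>Over the complex numbers \<open>q\<close> splits into linear factors. Each root lies off
  \<open>X\<close>, hence off the spectrum, so each factor is invertible at \<open>B\<close>.
  Nonemptiness of \<open>X\<close> excludes \<open>q = 0\<close>.\<close>

lemma invertible_matrix_poly:
  assumes "spectrum B \<subseteq> X" "X \<noteq> {}" "\<forall>z\<in>X. poly q z \<noteq> 0"
  shows "invertible (matrix_poly q B)"
  using assms(3)
proof (induction "degree q" arbitrary: q)
  case 0
  then obtain a where "q = [:a:]" by (metis degree_eq_zeroE)
  with 0 assms(2) show ?case by (auto simp: matrix_poly_const intro: invertible_mat)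
next
  case (Suc n)
  then have "\<not> constant (poly q)" by (simp add: constant_degree)
  then obtain r where r: "poly q r = 0" using fundamental_theorem_of_algebra by blast
  then obtain q' where q': "q = [:-r, 1:] * q'" by (auto simp: poly_eq_0_iff_dvd)
  have "q' \<noteq> 0" using Suc.hyps(2) q' by auto
  then have "degree q' = n" using Suc.hyps(2) unfolding q' by (subst (asm) degree_mult_eq) auto
  moreover have "\<forall>z\<in>X. poly q' z \<noteq> 0" using Suc.prems by (auto simp: q')
  ultimately have "invertible (matrix_poly q' B)" using Suc.hyps(1) by auto
  moreover have "invertible (B - mat r)"
  proof -
    have "invertible (mat r - B)"
      using r Suc.prems assms(1) by (auto simp: spectrum_def)
    then have "invertible (mat (-1) ** (mat r - B))"
      by (intro invertible_mult invertible_mat) auto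
    also have "mat (-1) ** (mat r - B) = B - mat r"
      by (simp add: matrix_eq matrix_vector_mult_diff_rdistrib mat_vector_mult
          vector_ssub_ldistrib flip: matrix_vector_mul_assoc vector_sneg_minus1)
    finally show ?thesis .
  qed
  ultimately show ?case by (simp only: q' matrix_poly_linear_factor invertible_mult)
qed

text \<open>Writing vectors as \<open>q(B) x\<close> clears denominators. Moebius transforms are
  evaluated this way, without a composition rule for the calculus.\<close>

lemma matrix_ratfun_vector:
  assumes "invertible (matrix_poly q B)"
  shows "matrix_ratfun p q B *v (matrix_poly q B *v x) = matrix_poly p B *v x"
  using matrix_inv_left[OF assms]
  by (simp add: matrix_ratfun_def matrix_vector_mul_assoc flip: matrix_mul_assoc)

lemma matrix_ratfun_smult_vector:
  "matrix_ratfun (smult a p) q B *v x = a *s (matrix_ratfun p q B *v x)"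
  by (simp add: matrix_ratfun_def matrix_poly_smult_vector flip: matrix_vector_mul_assoc)

text \<open>Conjugation fixes scalar matrices and respects products, so it passes through the Horner
  step \<open>matrix_poly_pCons\<close>.\<close>

lemma matrix_poly_similar:
  fixes A S :: "complex^'n^'n"
  assumes "invertible S"
  shows "matrix_poly p (matrix_inv S ** A ** S) = matrix_inv S ** matrix_poly p A ** S"
proof (induction p)
  case 0
  then show ?case by (simp add: matrix_poly_0)
next
  case (pCons a p)
  have S: "S ** matrix_inv S = mat 1" "matrix_inv S ** S = mat 1"
    using assms by (simp_all add: matrix_inv_right matrix_inv_left)
  have "matrix_inv S ** mat a ** S = mat a"
    using S by (metis mat_commute matrix_mul_assoc matrix_mul_rid)
  moreover have "matrix_inv S ** A ** S ** (matrix_inv S ** matrix_poly p A ** S)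
      = matrix_inv S ** (A ** matrix_poly p A) ** S"
    using S(1) by (metis matrix_mul_assoc matrix_mul_rid)
  ultimately show ?case
    using pCons by (simp add: matrix_poly_pCons matrix_add_ldistrib matrix_add_rdistrib)
qed

lemma matrix_ratfun_similar:
  fixes A S :: "complex^'n^'n"
  assumes S: "invertible S" and q: "invertible (matrix_poly q A)"
  shows "matrix_ratfun p q (matrix_inv S ** A ** S) = matrix_inv S ** matrix_ratfun p q A ** S"
proof -
  let ?T = "matrix_inv S" and ?Q = "matrix_poly q A"
  have cancel: "S ** (?T ** X) = X" "?Q ** (matrix_inv ?Q ** X) = X" "matrix_inv ?Q ** (?Q ** X) = X"
    for X :: "complex^'n^'n"
    using S q by (simp_all add: matrix_mul_assoc matrix_inv_right matrix_inv_left)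
  have "matrix_inv (?T ** ?Q ** S) = ?T ** matrix_inv ?Q ** S"
    by (rule matrix_inv_unique)
      (simp_all add: cancel matrix_inv_left[OF S] flip: matrix_mul_assoc)
  then show ?thesis
    unfolding matrix_ratfun_def matrix_poly_similar[OF S]
    by (simp add: cancel flip: matrix_mul_assoc)
qed

section \<open>Norms\<close>

lemma norm_matrix_vector_le: "norm (B *v x) \<le> opnorm B * norm x"
  unfolding opnorm_def by (intro onorm matrix_vector_mul_bounded_linear)

lemma opnorm_nonneg: "0 \<le> opnorm B"
  unfolding opnorm_def by (intro onorm_pos_le matrix_vector_mul_bounded_linear)

lemma opnorm_le: "0 \<le> b \<Longrightarrow> (\<And>x. norm (B *v x) \<le> b * norm x) \<Longrightarrow> opnorm B \<le> b"
  unfolding opnorm_def by (rule onorm_bound)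

lemma norm_vector_smult: "norm (a *s x) = cmod a * norm (x :: complex^'n)"
  by (simp add: norm_vec_def norm_mult L2_set_right_distrib)

lemma norm_axis: "norm (axis k c) = norm c"
proof -
  have "(norm (axis k c $ i))\<^sup>2 = (if i = k then (norm c)\<^sup>2 else 0)" for i
    by (simp add: axis_def)
  then show ?thesis by (simp add: norm_vec_def L2_set_def)
qed

lemma opnorm_mat: "opnorm (mat a :: complex^'n^'n) = cmod a"
proof (rule antisym)
  show "opnorm (mat a :: complex^'n^'n) \<le> cmod a"
    by (rule opnorm_le) (simp_all add: mat_vector_mult norm_vector_smult)
  show "cmod a \<le> opnorm (mat a :: complex^'n^'n)"
    using norm_matrix_vector_le[of "mat a :: complex^'n^'n" "axis undefined 1"]
    by (simp add: mat_vector_mult norm_vector_smult norm_axis)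
qed

section \<open>The Hermitian inner product and first-order optimality\<close>

definition herm :: "complex^'n \<Rightarrow> complex^'n \<Rightarrow> complex" where
  "herm x y = (\<Sum>i\<in>UNIV. x $ i * cnj (y $ i))"

lemma herm_commute: "herm y x = cnj (herm x y)"
  by (simp add: herm_def mult.commute)

lemma norm_vec_power2: "(norm x)\<^sup>2 = (\<Sum>i\<in>UNIV. (norm (x $ i))\<^sup>2)"
  by (simp add: norm_vec_def L2_set_def sum_nonneg)

lemma herm_self: "herm x x = of_real ((norm x)\<^sup>2)"
  by (simp only: herm_def norm_vec_power2 of_real_sum complex_norm_square)

lemma herm_smult_right: "herm x (a *s y) = cnj a * herm x y"
  by (simp add: herm_def sum_distrib_left mult_ac)

lemma herm_smult_left: "herm (a *s x) y = a * herm x y"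
  by (simp add: herm_def sum_distrib_left mult_ac)

lemma herm_add_left: "herm (x + x') y = herm x y + herm x' y"
  by (simp add: herm_def sum.distrib distrib_right)

lemma norm_add_smult_power2:
  "(norm (u + a *s y))\<^sup>2 = (norm u)\<^sup>2 + 2 * Re (cnj a * herm u y) + (cmod a)\<^sup>2 * (norm y)\<^sup>2"
proof -
  have *: "(cmod (p + a * q))\<^sup>2 = (cmod p)\<^sup>2 + 2 * Re (cnj a * (p * cnj q)) + (cmod a)\<^sup>2 * (cmod q)\<^sup>2"
    for p q
    unfolding cmod_power2 by (simp add: power2_eq_square algebra_simps)
  show ?thesis
    by (simp add: norm_vec_power2 * sum.distrib herm_def sum_distrib_left)
qed

text \<open>Only the component of \<open>v\<close> along \<open>y\<close> changes: it is multiplied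
  by \<open>1 + a\<close>, and \<open>(1 + a)^2 - 1 = 2 * a + a^2\<close>.\<close>

lemma norm_add_projection_power2:
  assumes "norm y = 1"
  shows "(norm (v + (of_real a * herm v y) *s y))\<^sup>2 = (norm v)\<^sup>2 + (2 * a + a\<^sup>2) * (cmod (herm v y))\<^sup>2"
proof -
  have "Re (cnj (of_real a * herm v y) * herm v y) = a * (cmod (herm v y))\<^sup>2"
    unfolding cmod_power2 by (simp add: power2_eq_square algebra_simps)
  then show ?thesis
    unfolding norm_add_smult_power2 assms
    by (simp add: norm_mult power_mult_distrib algebra_simps)
qed

text \<open>Cauchy-Schwarz for a unit vector: with \<open>a = -1\<close> the preceding identity
  gives the squared norm of \<open>v\<close> minus its projection onto \<open>y\<close>.\<close>

lemma cmod_herm_le: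
  assumes "norm y = 1"
  shows "cmod (herm v y) \<le> norm v"
proof -
  have "(norm v)\<^sup>2 - (cmod (herm v y))\<^sup>2 = (norm (v + (of_real (-1) * herm v y) *s y))\<^sup>2"
    by (simp only: norm_add_projection_power2[OF assms]) simp
  also have "\<dots> \<ge> 0" by (rule zero_le_power2)
  finally have "(cmod (herm v y))\<^sup>2 \<le> (norm v)\<^sup>2" by simp
  then show ?thesis by (rule power2_le_imp_le) (rule norm_ge_zero)
qed

text \<open>
  The hypothesis says that \<open>M\<close> also bounds the norms of the Moebius transforms
  \<open>(F - \<epsilon>)(1 - cnj \<epsilon> F)\<^sup>-\<^sup>1\<close> of an operator \<open>F\<close> with \<open>F x = u\<close>; the conclusion is first-order
  optimality at \<open>\<epsilon> = 0\<close>.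
\<close>
lemma herm_zero_if_extremal:
  assumes x: "norm x = 1" and u: "norm u = M" and M: "M > 1"
    and moebius: "\<And>\<epsilon>. cmod \<epsilon> < 1 \<Longrightarrow> norm (u - \<epsilon> *s x) \<le> M * norm (x - cnj \<epsilon> *s u)"
  shows "herm u x = 0"
proof (rule ccontr)
  assume nz: "herm u x \<noteq> 0"
  define h where "h = (cmod (herm u x))\<^sup>2"
  \<comment> \<open>This size makes the first-order gain outweigh the second-order terms and, as
    \<open>t * M < 1\<close>, keeps \<open>\<epsilon>\<close> in the disc. The direction of
    \<open>\<epsilon>\<close> makes both cross terms equal to \<open>- t * h\<close>.\<close>
  define t where "t = 1 / (M\<^sup>2 + 1)"
  define \<epsilon> where "\<epsilon> = of_real t * herm u x"
  have h: "h > 0" using nz by (simp add: h_def)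
  have t: "t > 0" by (simp add: t_def add_nonneg_pos)
  have "1 * M < M * M" using M by (intro mult_strict_right_mono) auto
  then have "M < M\<^sup>2 + 1" by (simp add: power2_eq_square)
  then have "t * M < 1" using M by (simp add: t_def divide_simps)
  moreover have "cmod \<epsilon> \<le> t * M"
    using cmod_herm_le[OF x, of u] t u by (simp add: \<epsilon>_def norm_mult)
  ultimately have "cmod \<epsilon> < 1" by simp
  from moebius[OF this]
  have le: "(norm (u + (-\<epsilon>) *s x))\<^sup>2 \<le> M\<^sup>2 * (norm (x + (- cnj \<epsilon>) *s u))\<^sup>2"
    by (smt (verit, best) norm_ge_zero power_mono power_mult_distrib vector_smult_lneg
        add_uminus_conv_diff)
  have 1: "Re (cnj (-\<epsilon>) * herm u x) = - t * h"
    unfolding \<epsilon>_def h_def cmod_power2 by (simp add: power2_eq_square algebra_simps)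
  have 2: "Re (cnj (- cnj \<epsilon>) * herm x u) = - t * h"
    unfolding \<epsilon>_def h_def cmod_power2 herm_commute[of x u]
    by (simp add: power2_eq_square algebra_simps)
  have 3: "(cmod \<epsilon>)\<^sup>2 = t\<^sup>2 * h"
    by (simp add: \<epsilon>_def h_def norm_mult power_mult_distrib)
  from le have "M\<^sup>2 - 2 * t * h + t\<^sup>2 * h \<le> M\<^sup>2 * (1 - 2 * t * h + t\<^sup>2 * h * M\<^sup>2)"
    unfolding norm_add_smult_power2 1 2 using x u 3 by (simp add: mult.assoc)
  \<comment> \<open>By the choice of \<open>t\<close> the last factor equals \<open>-1\<close>,
    while the others are positive.\<close>
  then have "0 \<le> (M\<^sup>2 - 1) * t * h * (t * (M\<^sup>2 + 1) - 2)"
    by (simp add: algebra_simps power2_eq_square)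
  also have "t * (M\<^sup>2 + 1) = 1"
    using t by (simp add: t_def)
  finally have "(M\<^sup>2 - 1) * t * h \<le> 0" by simp
  moreover have "(M\<^sup>2 - 1) * t * h > 0" using M t h by (simp add: one_less_power)
  ultimately show False by simp
qed

section \<open>Rank-one dilations and their condition numbers\<close>

text \<open>For a unit vector \<open>y\<close> this multiplies \<open>y\<close> by
  \<open>1 + a\<close> and fixes its orthogonal complement.\<close>

definition dilation :: "complex^'n \<Rightarrow> real \<Rightarrow> complex^'n^'n" where
  "dilation y a = mat 1 + (\<chi> i j. of_real a * y $ i * cnj (y $ j))"

lemma dilation_vector: "dilation y a *v v = v + (of_real a * herm v y) *s y"
proof -
  have "(\<chi> i j. of_real a * y $ i * cnj (y $ j)) *v v = (of_real a * herm v y) *s y"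
    by (simp add: vec_eq_iff matrix_vector_mult_def herm_def sum_distrib_left sum_distrib_right
        mult_ac)
  then show ?thesis by (simp add: dilation_def matrix_vector_mult_add_rdistrib)
qed

text \<open>The condition on \<open>a\<close> and \<open>b\<close> says
  \<open>(1 + a) * (1 + b) = 1\<close>: the factors along \<open>y\<close> cancel.\<close>

lemma dilation_mult:
  assumes "norm y = 1" "a + b + a * b = 0"
  shows "dilation y a ** dilation y b = mat 1"
proof -
  have "dilation y a *v (dilation y b *v v) = v" for v
  proof -
    let ?h = "herm v y"
    have "dilation y a *v (dilation y b *v v)
        = v + (of_real b * ?h + of_real a * (?h + of_real b * ?h)) *s y"
      by (simp only: dilation_vector herm_add_left herm_smult_left herm_self assms(1)
          vector_sadd_rdistrib add.assoc one_power2 of_real_1 mult_1_right)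
    also have "of_real b * ?h + of_real a * (?h + of_real b * ?h) = of_real (a + b + a * b) * ?h"
      by (simp add: algebra_simps)
    finally show ?thesis by (simp add: assms(2))
  qed
  then show ?thesis by (simp add: matrix_eq flip: matrix_vector_mul_assoc)
qed

text \<open>The factors \<open>1\<close> and \<open>1 + a\<close> act on orthogonal subspaces, so
  the larger modulus bounds the norm.\<close>

lemma opnorm_dilation_le:
  assumes y: "norm y = 1" and b: "1 \<le> b" "\<bar>1 + a\<bar> \<le> b"
  shows "opnorm (dilation y a) \<le> b"
proof (rule opnorm_le)
  fix v
  let ?h = "(cmod (herm v y))\<^sup>2"
  have h: "0 \<le> ?h" "?h \<le> (norm v)\<^sup>2"
    by (rule zero_le_power2) (intro power_mono cmod_herm_le y norm_ge_zero)
  have "(1 + a)\<^sup>2 \<le> b\<^sup>2" using power_mono[OF b(2), of 2] by simp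
  then have "2 * a + a\<^sup>2 \<le> b\<^sup>2 - 1" by (simp add: power2_eq_square algebra_simps)
  then have "(2 * a + a\<^sup>2) * ?h \<le> (b\<^sup>2 - 1) * ?h" using h by (intro mult_right_mono)
  also have "\<dots> \<le> (b\<^sup>2 - 1) * (norm v)\<^sup>2" using h(2) b(1) by (intro mult_left_mono) simp_all
  finally have "(2 * a + a\<^sup>2) * ?h \<le> b\<^sup>2 * (norm v)\<^sup>2 - (norm v)\<^sup>2"
    by (simp add: left_diff_distrib)
  then have "(norm (dilation y a *v v))\<^sup>2 \<le> (b * norm v)\<^sup>2"
    unfolding dilation_vector norm_add_projection_power2[OF y] power_mult_distrib by linarith
  then show "norm (dilation y a *v v) \<le> b * norm v"
    by (rule power2_le_imp_le) (intro mult_nonneg_nonneg norm_ge_zero order_trans[OF zero_le_one b(1)])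
qed (use b in auto)

text \<open>Shrinking \<open>y\<close> by \<open>1 / s\<close> has norm at most \<open>1\<close>,
  and its inverse, stretching \<open>y\<close> by \<open>s\<close>, has norm at most
  \<open>s\<close>.\<close>

lemma dilation_inverse:
  assumes y: "norm y = 1" and s: "s \<ge> 1"
  shows "invertible (dilation y (1 / s - 1))"
    and "matrix_inv (dilation y (1 / s - 1)) = dilation y (s - 1)"
    and "cond_number (dilation y (1 / s - 1)) \<le> s"
proof -
  let ?S = "dilation y (1 / s - 1)" and ?T = "dilation y (s - 1)"
  have ST: "?S ** ?T = mat 1" "?T ** ?S = mat 1"
    using s by (auto intro!: dilation_mult[OF y] simp: field_simps)
  then show "invertible ?S" by (auto simp: invertible_def)
  show T: "matrix_inv ?S = ?T" using ST by (rule matrix_inv_unique)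
  have "opnorm ?S \<le> 1" "opnorm ?T \<le> s"
    using s by (auto intro!: opnorm_dilation_le[OF y])
  then show "cond_number ?S \<le> s"
    unfolding cond_number_def T
    using mult_mono[of "opnorm ?S" 1 "opnorm ?T" s] opnorm_nonneg[of ?T] by simp
qed

section \<open>Spectral sets\<close>

lemma spectral_set_nonempty:
  assumes "spectral_set C X (B :: complex^'n^'n)"
  shows "X \<noteq> {}"
proof
  assume "X = {}"
  \<comment> \<open>the supremum over the empty set is a fixed real, but constants have arbitrarily large norm\<close>
  then have "opnorm (matrix_ratfun [:a:] 1 B) \<le> C * Sup {}" for a
    using assms by (auto simp: spectral_set_def)
  moreover have "matrix_ratfun [:a:] 1 B = mat a" for a
    by (simp only: matrix_ratfun_def matrix_poly_const one_pCons matrix_inv_mat_1 matrix_mul_rid)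
  ultimately have "cmod a \<le> C * Sup {}" for a
    by (metis opnorm_mat)
  from this[of "of_real (\<bar>C * Sup {}\<bar> + 1)"] show False
    unfolding norm_of_real by linarith
qed

text \<open>A pointwise bound, unlike a supremum, is inherited by subsets without further
  conditions; this allows passing from the closure of the domain to a spectral set inside
  it.\<close>

lemma spectral_set_bound:
  assumes sp: "spectral_set C X B"
    and q: "\<And>z. z \<in> X \<Longrightarrow> poly q z \<noteq> 0"
    and b: "\<And>z. z \<in> X \<Longrightarrow> cmod (poly p z / poly q z) \<le> b"
  shows "opnorm (matrix_ratfun p q B) \<le> C * b"
proof -
  have "opnorm (matrix_ratfun p q B) \<le> C * (SUP z\<in>X. cmod (poly p z / poly q z))"
    using sp q unfolding spectral_set_def by blast
  also have "\<dots> \<le> C * b"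
  proof (rule mult_left_mono)
    show "(SUP z\<in>X. cmod (poly p z / poly q z)) \<le> b"
      using b by (intro cSUP_least spectral_set_nonempty[OF sp]) auto
    show "0 \<le> C" using sp by (simp add: spectral_set_def)
  qed
  finally show ?thesis .
qed

text \<open>These pairs represent the rational functions \<open>p / q\<close> bounded by
  \<open>1\<close> on \<open>X\<close>. The division-free form suits linear combinations of
  \<open>p\<close> and \<open>q\<close>.\<close>

definition unit_ratfuns :: "complex set \<Rightarrow> (complex poly \<times> complex poly) set" where
  "unit_ratfuns X = {(p, q). \<forall>z\<in>X. poly q z \<noteq> 0 \<and> cmod (poly p z) \<le> cmod (poly q z)}"

text \<open>With \<open>f = p / q\<close>, the new pair is
  \<open>(f - \<epsilon>) / (1 - cnj \<epsilon> * f)\<close> after multiplying numerator and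
  denominator by \<open>q\<close>; this Moebius map preserves the closed unit disc.\<close>

lemma moebius_ratfun:
  assumes pq: "(p, q) \<in> unit_ratfuns X" and \<epsilon>: "cmod \<epsilon> < 1"
  shows "(p + smult (-\<epsilon>) q, q + smult (- cnj \<epsilon>) p) \<in> unit_ratfuns X"
proof -
  have "b + - cnj \<epsilon> * a \<noteq> 0 \<and> cmod (a + - \<epsilon> * b) \<le> cmod (b + - cnj \<epsilon> * a)"
    if ab: "b \<noteq> 0" "cmod a \<le> cmod b" for a b
  proof
    have "cmod (cnj \<epsilon> * a) < cmod b"
    proof -
      have "cmod \<epsilon> * cmod a \<le> cmod \<epsilon> * cmod b" using ab by (intro mult_left_mono) auto
      also have "\<dots> < cmod b" using \<epsilon> ab by simp
      finally show ?thesis by (simp add: norm_mult)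
    qed
    then show "b + - cnj \<epsilon> * a \<noteq> 0" by auto
    have "(cmod (b + - cnj \<epsilon> * a))\<^sup>2 - (cmod (a + - \<epsilon> * b))\<^sup>2
        = (1 - (cmod \<epsilon>)\<^sup>2) * ((cmod b)\<^sup>2 - (cmod a)\<^sup>2)"
      unfolding cmod_power2 by (simp add: power2_eq_square algebra_simps)
    moreover have "(cmod \<epsilon>)\<^sup>2 \<le> 1" using \<epsilon> by (simp add: power_le_one)
    moreover have "(cmod a)\<^sup>2 \<le> (cmod b)\<^sup>2" using ab by (simp add: power_mono)
    ultimately have "(cmod (a + - \<epsilon> * b))\<^sup>2 \<le> (cmod (b + - cnj \<epsilon> * a))\<^sup>2"
      by (smt (verit) mult_nonneg_nonneg)
    then show "cmod (a + - \<epsilon> * b) \<le> cmod (b + - cnj \<epsilon> * a)"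
      by (rule power2_le_imp_le) simp
  qed
  then show ?thesis using pq by (auto simp: unit_ratfuns_def simp del: mult_minus_left)
qed

text \<open>The pairs \<open>(x, f(A) x)\<close> form a bounded set in finite dimension, so the norm
  of the second entry has a maximum on its closure. The other conclusions are closed conditions and
  survive the limit; the last one carries bounds for similar matrices to it.\<close>

lemma extremal_pair:
  fixes A :: "complex^'n^'n"
  assumes spec: "spectrum A \<subseteq> X" "X \<noteq> {}"
    and bound: "\<And>p q. (p, q) \<in> unit_ratfuns X \<Longrightarrow> opnorm (matrix_ratfun p q A) \<le> C"
  obtains x u where "norm x = 1"
    "\<And>p q. (p, q) \<in> unit_ratfuns X \<Longrightarrow> opnorm (matrix_ratfun p q A) \<le> norm u"
    "\<And>\<epsilon>. cmod \<epsilon> < 1 \<Longrightarrow> norm (u - \<epsilon> *s x) \<le> norm u * norm (x - cnj \<epsilon> *s u)"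
    "\<And>(T :: complex^'n^'n) c. (\<And>p q v. (p, q) \<in> unit_ratfuns X \<Longrightarrow>
        norm (T *v (matrix_ratfun p q A *v v)) \<le> c * norm (T *v v)) \<Longrightarrow>
      norm (T *v u) \<le> c * norm (T *v x)"
proof -
  define V where "V = {(x, matrix_ratfun p q A *v x) | x p q. norm x = 1 \<and> (p, q) \<in> unit_ratfuns X}"
  have "V \<subseteq> cball 0 1 \<times> cball 0 C"
  proof (clarsimp simp: V_def)
    fix x :: "complex^'n" and p q assume "norm x = 1" "(p, q) \<in> unit_ratfuns X"
    then show "norm (matrix_ratfun p q A *v x) \<le> C"
      using norm_matrix_vector_le[of "matrix_ratfun p q A" x] bound by fastforce
  qed
  then have "bounded V" by (rule bounded_subset[rotated]) (intro bounded_Times bounded_cball)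
  then have "compact (closure V)" by (simp add: compact_closure)
  moreover have "(1, 1) \<in> unit_ratfuns X" by (simp add: unit_ratfuns_def)
  \<comment> \<open>Any basis vector will do, so the index is left as \<open>undefined\<close>; the
    function is the constant \<open>1\<close>.\<close>
  then have "(axis undefined 1, matrix_ratfun 1 1 A *v axis undefined 1) \<in> V"
    unfolding V_def by (auto simp: norm_axis intro!: exI)
  then have "closure V \<noteq> {}" by auto
  moreover have "continuous_on (closure V) (\<lambda>w. norm (snd w))" by (intro continuous_intros)
  ultimately have "\<exists>w\<in>closure V. \<forall>w'\<in>closure V. norm (snd w') \<le> norm (snd w)"
    by (rule continuous_attains_sup)
  then obtain w where w: "w \<in> closure V" "\<And>w'. w' \<in> closure V \<Longrightarrow> norm (snd w') \<le> norm (snd w)"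
    by metis
  obtain x u where xu: "w = (x, u)" by fastforce
  have closed_cond: "P w" if "closed {w. P w}" "\<And>w. w \<in> V \<Longrightarrow> P w" for P
  proof -
    have "V \<subseteq> {w. P w}" using that(2) by blast
    then have "closure V \<subseteq> {w. P w}" using that(1) by (rule closure_minimal)
    then show ?thesis using w(1) by blast
  qed
  have max: "opnorm (matrix_ratfun p q A) \<le> norm u" if pq: "(p, q) \<in> unit_ratfuns X" for p q
  proof (rule opnorm_le)
    fix v show "norm (matrix_ratfun p q A *v v) \<le> norm u * norm v"
    proof (cases "v = 0")
      case False
      let ?e = "of_real (1 / norm v) *s v"
      have "norm ?e = 1" using False by (simp add: norm_vector_smult norm_divide)
      then have "(?e, matrix_ratfun p q A *v ?e) \<in> closure V"
        using pq closure_subset by (fastforce simp: V_def)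
      from w(2)[OF this] have "norm (matrix_ratfun p q A *v ?e) \<le> norm u" by (simp add: xu)
      then show ?thesis
        using False by (simp add: vector_scalar_commute norm_vector_smult norm_divide field_simps)
    qed simp
  qed simp
  have cont: "continuous_on UNIV (\<lambda>w :: (complex^'n) \<times> (complex^'n). B *v fst w)"
    "continuous_on UNIV (\<lambda>w :: (complex^'n) \<times> (complex^'n). B *v snd w)"
    for B :: "complex^'n^'n"
    by (intro bounded_linear.continuous_on[OF matrix_vector_mul_bounded_linear] continuous_intros)+
  have "norm (fst w) = 1"
    by (rule closed_cond) (auto simp: V_def intro!: closed_Collect_eq continuous_intros)
  \<comment> \<open>The scalars appear as \<open>mat \<epsilon>\<close> so that \<open>cont\<close>
    gives continuity.\<close>
  moreover have "norm (snd w - mat \<epsilon> *v fst w) \<le> norm u * norm (fst w - mat (cnj \<epsilon>) *v snd w)"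
    if \<epsilon>: "cmod \<epsilon> < 1" for \<epsilon>
  proof (rule closed_cond)
    show "closed {w :: (complex^'n) \<times> (complex^'n).
        norm (snd w - mat \<epsilon> *v fst w) \<le> norm u * norm (fst w - mat (cnj \<epsilon>) *v snd w)}"
      by (intro closed_Collect_le continuous_intros cont)
  next
    fix w' assume "w' \<in> V"
    then obtain v p q where v: "w' = (v, matrix_ratfun p q A *v v)" and pq: "(p, q) \<in> unit_ratfuns X"
      by (auto simp: V_def)
    let ?p = "p + smult (-\<epsilon>) q" and ?q = "q + smult (- cnj \<epsilon>) p"
    have pq': "(?p, ?q) \<in> unit_ratfuns X" using moebius_ratfun[OF pq \<epsilon>] .
    have inv: "invertible (matrix_poly q A)" "invertible (matrix_poly ?q A)"
      using pq pq' by (auto simp: unit_ratfuns_def intro!: invertible_matrix_poly[OF spec])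
    \<comment> \<open>Now \<open>v = q(A) z\<close> and \<open>f(A) v = p(A) z\<close>, so the
      Moebius numerator and denominator send \<open>z\<close> to
      \<open>f(A) v - \<epsilon> v\<close> and \<open>v - cnj \<epsilon> f(A) v\<close>.\<close>
    define z where "z = matrix_inv (matrix_poly q A) *v v"
    have v': "v = matrix_poly q A *v z"
      using matrix_inv_right[OF inv(1)] by (simp add: z_def matrix_vector_mul_assoc)
    have F: "matrix_ratfun p q A *v v = matrix_poly p A *v z"
      unfolding v' by (rule matrix_ratfun_vector[OF inv(1)])
    have "norm (matrix_ratfun ?p ?q A *v (matrix_poly ?q A *v z)) \<le> norm u * norm (matrix_poly ?q A *v z)"
      using norm_matrix_vector_le max[OF pq'] by (meson mult_right_mono norm_ge_zero order_trans)
    then show "norm (snd w' - mat \<epsilon> *v fst w') \<le> norm u * norm (fst w' - mat (cnj \<epsilon>) *v snd w')"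
      unfolding matrix_ratfun_vector[OF inv(2)]
      unfolding matrix_poly_add_vector matrix_poly_smult_vector v'[symmetric]
      by (simp add: v F mat_vector_mult vector_smult_lneg)
  qed
  moreover have "norm (T *v snd w) \<le> c * norm (T *v fst w)"
    if "\<And>p q v. (p, q) \<in> unit_ratfuns X \<Longrightarrow>
        norm (T *v (matrix_ratfun p q A *v v)) \<le> c * norm (T *v v)" for T :: "complex^'n^'n" and c
    by (rule closed_cond)
      (use that in \<open>auto simp: V_def intro!: closed_Collect_le continuous_intros cont\<close>)
  ultimately show ?thesis using that[of x u] max by (simp add: xu mat_vector_mult)
qed

text \<open>The two terms of the maximum match the two cases for the extremal norm: at most
  \<open>1\<close>, or above \<open>1\<close>, where orthogonality is available.\<close>

lemma opnorm_matrix_ratfun_le: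
  fixes A :: "complex^'n^'n"
  assumes spec: "spectrum A \<subseteq> X" "X \<noteq> {}" and \<gamma>: "\<gamma> > 1"
    and similar: "\<And>S p q. invertible S \<Longrightarrow> cond_number S < \<gamma> \<Longrightarrow> (p, q) \<in> unit_ratfuns X \<Longrightarrow>
      opnorm (matrix_ratfun p q (matrix_inv S ** A ** S)) \<le> C"
    and pq: "(p, q) \<in> unit_ratfuns X"
  shows "opnorm (matrix_ratfun p q A) \<le> max 1 (C / \<gamma>)"
proof -
  \<comment> \<open>The identity has condition number \<open>1 < \<gamma>\<close>, which gives the a
    priori bound needed for compactness.\<close>
  have bound: "opnorm (matrix_ratfun p q A) \<le> C" if "(p, q) \<in> unit_ratfuns X" for p q
    using similar[of "mat 1", OF _ _ that] \<gamma>
    by (simp add: cond_number_def opnorm_mat invertible_mat matrix_inv_mat_1)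
  obtain x u where x: "norm x = 1"
    and max: "\<And>p q. (p, q) \<in> unit_ratfuns X \<Longrightarrow> opnorm (matrix_ratfun p q A) \<le> norm u"
    and moebius: "\<And>\<epsilon>. cmod \<epsilon> < 1 \<Longrightarrow> norm (u - \<epsilon> *s x) \<le> norm u * norm (x - cnj \<epsilon> *s u)"
    and limit: "\<And>(T :: complex^'n^'n) c. (\<And>p q v. (p, q) \<in> unit_ratfuns X \<Longrightarrow>
        norm (T *v (matrix_ratfun p q A *v v)) \<le> c * norm (T *v v)) \<Longrightarrow>
      norm (T *v u) \<le> c * norm (T *v x)"
    using extremal_pair[OF spec bound] by metis
  have "norm u \<le> C / \<gamma>" if M: "norm u > 1"
  proof -
    define y where "y = of_real (1 / norm u) *s u"
    have y: "norm y = 1" using M by (auto simp: y_def norm_vector_smult norm_divide)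
    have orth: "herm u x = 0" by (rule herm_zero_if_extremal[OF x refl M moebius])
    have "s * norm u \<le> C" if s: "1 \<le> s" "s < \<gamma>" for s
    proof -
      let ?S = "dilation y (1 / s - 1)" and ?T = "dilation y (s - 1)"
      note S = dilation_inverse[OF y s(1)]
      have "herm x y = 0" using orth by (simp add: y_def herm_smult_right herm_commute[of x u])
      then have Tx: "?T *v x = x" by (simp add: dilation_vector)
      \<comment> \<open>As \<open>y\<close> is the normalised \<open>u\<close>,
        \<open>herm u y\<close> is the norm of \<open>u\<close>, so \<open>?T\<close> scales
        \<open>u\<close> by exactly \<open>s\<close>.\<close>
      have "of_real (s - 1) * herm u y * of_real (1 / norm u) = (of_real (s - 1) :: complex)"
        using M by (auto simp: y_def herm_smult_right herm_self power2_eq_square)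
      then have "?T *v u = u + of_real (s - 1) *s u"
        by (simp add: dilation_vector y_def vector_smult_assoc)
      also have "\<dots> = of_real s *s u"
        by (simp add: vec_eq_iff algebra_simps)
      finally have Tu: "norm (?T *v u) = s * norm u" using s by (simp add: norm_vector_smult)
      have "norm (?T *v u) \<le> C * norm (?T *v x)"
      proof (rule limit)
        fix p q v assume pq: "(p, q) \<in> unit_ratfuns X"
        let ?F = "matrix_ratfun p q A"
        have "invertible (matrix_poly q A)"
          using pq by (auto simp: unit_ratfuns_def intro!: invertible_matrix_poly[OF spec])
        then have "matrix_ratfun p q (matrix_inv ?S ** A ** ?S) = ?T ** ?F ** ?S"
          using matrix_ratfun_similar[OF S(1)] S(2) by simp
        then have "opnorm (?T ** ?F ** ?S) \<le> C"
          using similar[OF S(1) _ pq] S(3) s(2) by simp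
        \<comment> \<open>Evaluating at \<open>?T *v v\<close> cancels \<open>?S\<close> and leaves
          an inequality of the form that \<open>limit\<close> accepts.\<close>
        then have "norm ((?T ** ?F ** ?S) *v (?T *v v)) \<le> C * norm (?T *v v)"
          using norm_matrix_vector_le by (meson mult_right_mono norm_ge_zero order_trans)
        moreover have "(?T ** ?F ** ?S) ** ?T = ?T ** ?F"
          using matrix_inv_right[OF S(1)] S(2) by (simp flip: matrix_mul_assoc)
        ultimately show "norm (?T *v (?F *v v)) \<le> C * norm (?T *v v)"
          by (simp add: matrix_vector_mul_assoc)
      qed
      then show ?thesis by (simp add: Tx Tu x)
    qed
    then have "s \<le> C / norm u" if "1 < s" "s < \<gamma>" for s
      using that M by (subst pos_le_divide_eq) auto
    \<comment> \<open>The hypothesis only covers condition numbers strictly below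
      \<open>\<gamma>\<close>, so \<open>s\<close> tends to \<open>\<gamma>\<close> from
      below.\<close>
    then have "\<gamma> \<le> C / norm u" by (rule dense_le_bounded[OF \<gamma>])
    moreover have "0 < \<gamma>" "0 < norm u" using M \<gamma> by linarith+
    ultimately show ?thesis by (simp only: pos_le_divide_eq mult.commute)
  qed
  then have "norm u \<le> max 1 (C / \<gamma>)" by linarith
  with max[OF pq] show ?thesis by linarith
qed

section \<open>From functions bounded by one to arbitrary rational functions\<close>

theorem theorem3p3:
  fixes C \<gamma> :: real
    and K :: "complex^'n^'n \<Rightarrow> complex set"
    and A :: "complex^'n^'n"
    and D :: "complex set"
  assumes "CARD('n) \<ge> 2"
    and "C \<ge> 1"
    and "\<And>B. spectral_set C (K B) B"
    and "open D" and "connected D" and "D \<noteq> {}"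
    and "bounded D" and "convex D"
    and "spectrum A \<subseteq> D"
    and "\<gamma> > 1"
    and "\<And>S. invertible S \<Longrightarrow> cond_number S < \<gamma> \<Longrightarrow> K (matrix_inv S ** A ** S) \<subseteq> D"
  shows "spectral_constant D A \<le> ereal (max 1 (C / \<gamma>))"
proof -
  let ?X = "closure D" and ?c = "max 1 (C / \<gamma>)"
  have X: "compact ?X" "?X \<noteq> {}" "spectrum A \<subseteq> ?X"
    using assms(6,7,9) closure_subset[of D] by auto
  have bound: "opnorm (matrix_ratfun p q (matrix_inv S ** A ** S)) \<le> C * b"
    if "invertible S" "cond_number S < \<gamma>" "\<forall>z\<in>?X. poly q z \<noteq> 0"
      "\<forall>z\<in>?X. cmod (poly p z / poly q z) \<le> b" for S p q b
  proof -
    have "K (matrix_inv S ** A ** S) \<subseteq> ?X"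
      using assms(11)[OF that(1,2)] closure_subset by blast
    with that(3,4) show ?thesis
      by (intro spectral_set_bound[OF assms(3)]) auto
  qed
  have unit: "opnorm (matrix_ratfun p q A) \<le> ?c" if "(p, q) \<in> unit_ratfuns ?X" for p q
  proof (rule opnorm_matrix_ratfun_le[OF X(3,2) \<open>\<gamma> > 1\<close> _ that])
    fix S :: "complex^'n^'n" and p q
    assume "invertible S" "cond_number S < \<gamma>" "(p, q) \<in> unit_ratfuns ?X"
    then show "opnorm (matrix_ratfun p q (matrix_inv S ** A ** S)) \<le> C"
      using bound[of S q p 1] by (auto simp: unit_ratfuns_def norm_divide divide_simps)
  qed
  have "opnorm (matrix_ratfun p q A) \<le> ?c * (SUP z\<in>?X. cmod (poly p z / poly q z))"
    if q: "\<forall>z\<in>?X. poly q z \<noteq> 0" for p q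
  proof -
    define s where "s = (SUP z\<in>?X. cmod (poly p z / poly q z))"
    have "compact ((\<lambda>z. cmod (poly p z / poly q z)) ` ?X)"
      using q X(1) by (intro compact_continuous_image continuous_intros) auto
    then have s: "cmod (poly p z / poly q z) \<le> s" if "z \<in> ?X" for z
      unfolding s_def using that by (intro cSUP_upper bounded_imp_bdd_above compact_imp_bounded)
    obtain z where "z \<in> D" using \<open>D \<noteq> {}\<close> by blast
    then have "z \<in> ?X" using closure_subset by blast
    from order_trans[OF norm_ge_zero s[OF this]] have s0: "s \<ge> 0" .
    \<comment> \<open>Normalising by \<open>r > s\<close> instead of \<open>s\<close> also covers
      \<open>s = 0\<close>; afterwards \<open>r\<close> decreases to \<open>s\<close>.\<close>
    have "norm (matrix_ratfun p q A *v x) \<le> (?c * r) * norm x" if r: "r > s" for r x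
    proof -
      have "cmod (poly p z) \<le> r * cmod (poly q z)" if "z \<in> ?X" for z
      proof -
        have "cmod (poly p z / poly q z) \<le> r" using s[OF that] r by simp
        then show ?thesis using q that by (simp add: norm_divide divide_simps)
      qed
      then have "(smult (of_real (1 / r)) p, q) \<in> unit_ratfuns ?X"
        using q r s0 by (auto simp: unit_ratfuns_def norm_mult norm_divide divide_simps mult.commute)
      from unit[OF this] have "norm (matrix_ratfun (smult (of_real (1 / r)) p) q A *v x) \<le> ?c * norm x"
        using norm_matrix_vector_le by (meson mult_right_mono norm_ge_zero order_trans)
      then show ?thesis
        using r s0
        by (simp add: matrix_ratfun_smult_vector norm_vector_smult norm_divide divide_simps mult_ac)
    qed
    then have le: "opnorm (matrix_ratfun p q A) \<le> ?c * r" if "r > s" for r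
      using that s0 by (intro opnorm_le) auto
    have c: "0 < ?c" by (rule less_le_trans[OF zero_less_one max.cobounded1])
    have "opnorm (matrix_ratfun p q A) / ?c \<le> s"
    proof (rule dense_ge)
      fix r assume "s < r"
      from le[OF this] show "opnorm (matrix_ratfun p q A) / ?c \<le> r"
        by (simp only: pos_divide_le_eq[OF c] mult.commute)
    qed
    then show ?thesis by (simp only: s_def pos_divide_le_eq[OF c] mult.commute)
  qed
  then have "spectral_set ?c ?X A"
    using X by (auto simp: spectral_set_def)
  then show ?thesis
    unfolding spectral_constant_def by (subst optimal_spectral_constant_le_iff) auto
qed

end
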